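(* Let $\theta \in (1/3, 1/2]$. The 2-term greedy underapproximation sequence of $\theta$ is a best 2-term Egyptian underapproximation sequence of $\theta$ if and only if \[ \theta \notin \left( \frac{9}{20}, \frac{11}{24} \right] \cup \left( \frac{11}{28}, \frac{19}{48} \right]. \] The 2-term greedy underapproximation sequence of $\theta$ is a best, but not the unique best, 2-term Egyptian underapproximation sequence of $\theta$ if and only if $\theta \in J(3,a_2) = \left( \frac{1}{3} + \frac{1}{a_2},\ \frac{1}{3} + \frac{1}{a_2 - 1}\right]$ for some \[ a_2 \in \{12, 15, 24, 30, 36, 60, 105, 132\}. \]
   Context: For $\theta \in (0,1]$, $U_2(\theta)$ is the set of pairs of integers $(x_1,x_2)$ with $2 \leq x_1 \leq x_2$ and $\frac{1}{x_1} + \frac{1}{x_2} < \theta$, and $u_2(\theta) = \sup\{\frac{1}{x_1}+\frac{1}{x_2} : (x_1,x_2) \in U_2(\theta)\}$. A pair $(x_1,x_2) \in U_2(\theta)$ is a best 2-term (Egyptian) underapproximation sequence of $\theta$ if $\frac{1}{x_1}+\frac{1}{x_2} = u_2(\theta)$; it is the unique best one if no other pair in $U_2(\theta)$ has this property. Let $G(\theta) = \lfloor 1/\theta\rfloor + 1$ (the unique integer $a\ge 2$ with $1/a<\theta\le 1/(a-1)$); the 2-term greedy underapproximation sequence of $\theta$ is $(a_1,a_2)$ with $a_1 = G(\theta)$, $a_2 = G(\theta - 1/a_1)$. For $\theta\in(1/3,1/2]$ one has $a_1 = 3$, and for $a_2\ge 7$ the 2-term greedy underapproximation sequence of every $\theta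 \in J(3,a_2)$ is $(3,a_2)$. *)

theory Defs
  imports Complex_Main
begin

definition pair_sum :: "int \<times> int \<Rightarrow> real" where
  "pair_sum p = 1 / of_int (fst p) + 1 / of_int (snd p)"

(* The definitions below are meant for \<theta> in (0,1]. There U2 \<theta> is nonempty and its
   sums are bounded, so that the real-valued Sup is the genuine supremum. *)

definition U2 :: "real \<Rightarrow> (int \<times> int) set" where
  "U2 \<theta> = {(x1, x2). 2 \<le> x1 \<and> x1 \<le> x2 \<and> pair_sum (x1, x2) < \<theta>}"

definition u2 :: "real \<Rightarrow> real" where
  "u2 \<theta> = (SUP p \<in> U2 \<theta>. pair_sum p)"

definition best_underapprox2 :: "real \<Rightarrow> int \<times> int \<Rightarrow> bool" where
  "best_underapprox2 \<theta> p \<longleftrightarrow> p \<in> U2 \<theta> \<and> pair_sum p = u2 \<theta>"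

definition unique_best_underapprox2 :: "real \<Rightarrow> int \<times> int \<Rightarrow> bool" where
  "unique_best_underapprox2 \<theta> p \<longleftrightarrow>
     best_underapprox2 \<theta> p \<and> (\<forall>q. best_underapprox2 \<theta> q \<longrightarrow> q = p)"

definition G :: "real \<Rightarrow> int" where
  "G \<theta> = \<lfloor>1 / \<theta>\<rfloor> + 1"

definition greedy2 :: "real \<Rightarrow> int \<times> int" where
  "greedy2 \<theta> = (G \<theta>, G (\<theta> - 1 / of_int (G \<theta>)))"

end

theory Submission
  imports Defs
begin

text \<open>
  A pair with first entry 3 never beats the greedy pair \<open>(3, a)\<close>. Any other pair with sum in
  \<open>(1/3, 1/2)\<close> has first entry 4 or 5, which leaves ten pairs, and each sum can be written as
  \<open>1/3 + 1/d\<close>. Such a pair beats \<open>(3, a)\<close> for some \<open>\<theta>\<close> in \<open>J(3, a)\<close> iff \<open>a - 1 < d < a\<close>, and it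
  ties iff \<open>d = a\<close>. The values of \<open>d\<close> are \<open>60/7\<close> for \<open>(4,5)\<close>, \<open>84/5\<close> for \<open>(4,7)\<close>, and the integers
  12, 15, 24, 30, 36, 60, 105, 132 for the remaining pairs.
\<close>

text \<open>All sums over \<open>U2 \<theta>\<close> lie below \<theta>, so the real
  \<open>SUP\<close> is genuine, and a member attains it exactly when it is a maximum. Suprema can
  be avoided from here on.\<close>

lemma best_underapprox2_iff:
  "best_underapprox2 \<theta> p \<longleftrightarrow> p \<in> U2 \<theta> \<and> (\<forall>q \<in> U2 \<theta>. pair_sum q \<le> pair_sum p)"
proof -
  have bdd: "bdd_above (pair_sum ` U2 \<theta>)"
    by (rule bdd_aboveI[of _ \<theta>]) (auto simp: U2_def)
  have "pair_sum p = u2 \<theta> \<longleftrightarrow> (\<forall>q \<in> U2 \<theta>. pair_sum q \<le> pair_sum p)" if "p \<in> U2 \<theta>"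
  proof
    assume "pair_sum p = u2 \<theta>"
    then show "\<forall>q \<in> U2 \<theta>. pair_sum q \<le> pair_sum p"
      using cSUP_upper[OF _ bdd] by (auto simp: u2_def)
  next
    assume "\<forall>q \<in> U2 \<theta>. pair_sum q \<le> pair_sum p"
    then show "pair_sum p = u2 \<theta>"
      unfolding u2_def using that by (intro cSup_eq_maximum[symmetric]) auto
  qed
  then show ?thesis
    by (auto simp: best_underapprox2_def)
qed

lemma not_unique_best_underapprox2_iff:
  assumes "best_underapprox2 \<theta> p"
  shows "\<not> unique_best_underapprox2 \<theta> p \<longleftrightarrow> (\<exists>q \<in> U2 \<theta>. q \<noteq> p \<and> pair_sum q = pair_sum p)"
  using assms by (auto simp: unique_best_underapprox2_def best_underapprox2_def)

text \<open>\<open>G t = a\<close> says a - 1 \<le> 1/t < a, and taking reciprocals gives the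
  interval; \<open>2 \<le> a\<close> keeps a - 1 positive.\<close>

lemma G_eq_iff:
  assumes "0 < t" "2 \<le> a"
  shows "G t = a \<longleftrightarrow> t \<in> {1 / of_int a<..1 / (of_int a - 1)}"
proof -
  have a: "real_of_int a \<ge> 2" using assms by simp
  have "G t = a \<longleftrightarrow> \<lfloor>1 / t\<rfloor> = a - 1"
    by (auto simp: G_def)
  also have "\<dots> \<longleftrightarrow> real_of_int a - 1 \<le> 1 / t \<and> 1 / t < real_of_int a"
    by (simp add: floor_eq_iff)
  also have "\<dots> \<longleftrightarrow> t \<in> {1 / of_int a<..1 / (of_int a - 1)}"
    using assms a by (auto simp: field_simps)
  finally show ?thesis .
qed

context
  fixes \<theta> :: real
  assumes \<theta>: "\<theta> \<in> {1/3<..1/2}"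
begin

text \<open>The first greedy entry is 3 throughout this range, so only the choice for \<theta> - 1/3
  remains; shifting its interval by 1/3 gives J(3, a).\<close>

lemma greedy2_eq_iff:
  assumes "2 \<le> a"
  shows "greedy2 \<theta> = (3, a) \<longleftrightarrow> \<theta> \<in> {1/3 + 1 / of_int a<..1/3 + 1 / (of_int a - 1)}"
proof -
  have "G \<theta> = 3"
    using \<theta> by (subst G_eq_iff) auto
  then have "greedy2 \<theta> = (3, a) \<longleftrightarrow> G (\<theta> - 1/3) = a"
    by (simp add: greedy2_def)
  also have "\<dots> \<longleftrightarrow> \<theta> \<in> {1/3 + 1 / of_int a<..1/3 + 1 / (of_int a - 1)}"
    using \<theta> assms by (subst G_eq_iff) auto
  finally show ?thesis .
qed

lemma greedy2_obtain:
  obtains a where "7 \<le> a" "greedy2 \<theta> = (3, a)"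
proof
  have "6 \<le> 1 / (\<theta> - 1/3)"
    using \<theta> by (auto simp: field_simps)
  then have "6 \<le> \<lfloor>1 / (\<theta> - 1/3)\<rfloor>"
    by (simp add: le_floor_iff)
  then show "7 \<le> G (\<theta> - 1/3)"
    by (simp add: G_def)
  have "G \<theta> = 3"
    using \<theta> by (subst G_eq_iff) auto
  then show "greedy2 \<theta> = (3, G (\<theta> - 1/3))"
    by (simp add: greedy2_def)
qed

text \<open>A first entry 2 already contributes 1/2 \<ge> \<theta>, and a first entry of at least 6
  gives a sum of at most 1/3. For 4 and 5 the two bounds on the sum confine the second
  entry.\<close>

lemma U2_cases:
  assumes "q \<in> U2 \<theta>" "1/3 < pair_sum q"
  shows "fst q = 3 \<or> q \<in> {(4,5), (4,6), (4,7), (4,8), (4,9), (4,10), (4,11), (5,5), (5,6), (5,7)}"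
proof -
  obtain b c where q: "q = (b, c)" by (cases q)
  have bc: "2 \<le> b" "b \<le> c" and lt: "1 / real_of_int b + 1 / real_of_int c < 1/2"
    and gt: "1/3 < 1 / real_of_int b + 1 / real_of_int c"
    using assms \<theta> by (auto simp: U2_def pair_sum_def q)
  have r: "real_of_int b \<ge> 2" "real_of_int b \<le> real_of_int c"
    using bc by auto
  have "b \<noteq> 2"
    using lt r by auto
  moreover have "b < 6"
  proof (rule ccontr)
    assume "\<not> b < 6"
    then have "real_of_int b \<ge> 6" "real_of_int c \<ge> 6"
      using bc by auto
    then have "1 / real_of_int b \<le> 1/6" "1 / real_of_int c \<le> 1/6"
      by (auto simp: field_simps)
    then show False using gt by linarith
  qed
  ultimately consider "b = 3" | "b = 4" | "b = 5"
    using bc by linarith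
  then show ?thesis
  proof cases
    case 1
    then show ?thesis by (simp add: q)
  next
    case 2
    \<comment> \<open>Here 1/12 < 1/c < 1/4.\<close>
    have "real_of_int c < 12" "4 < real_of_int c"
      using lt gt r 2 by (auto simp: field_simps)
    then have "c \<in> {5, 6, 7, 8, 9, 10, 11}"
      by auto
    then show ?thesis using 2 by (auto simp: q)
  next
    case 3
    \<comment> \<open>Here 1/c > 1/3 - 1/5 = 2/15, so c < 15/2.\<close>
    have "real_of_int c < 8"
      using gt r 3 by (auto simp: field_simps)
    then have "c \<in> {5, 6, 7}"
      using 3 bc by auto
    then show ?thesis using 3 by (auto simp: q)
  qed
qed

end

theorem theorem7p2:
  fixes \<theta> :: real
  assumes "\<theta> \<in> {1/3<..1/2}"
  shows "(best_underapprox2 \<theta> (greedy2 \<theta>) \<longleftrightarrow>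
            \<theta> \<notin> {9/20<..11/24} \<union> {11/28<..19/48}) \<and>
         (best_underapprox2 \<theta> (greedy2 \<theta>) \<and> \<not> unique_best_underapprox2 \<theta> (greedy2 \<theta>) \<longleftrightarrow>
            (\<exists>a2 \<in> {12, 15, 24, 30, 36, 60, 105, 132 :: int}.
               \<theta> \<in> {1/3 + 1 / of_int a2<..1/3 + 1 / (of_int a2 - 1)}))"
proof -
  obtain a where a: "7 \<le> a" and greedy: "greedy2 \<theta> = (3, a)"
    using greedy2_obtain[OF assms] .
  define A where "A = real_of_int a"
  have A: "A \<ge> 7"
    using a by (simp add: A_def)
  have lo: "1/3 + 1 / A < \<theta>" and hi: "\<theta> \<le> 1/3 + 1 / (A - 1)"
    using greedy2_eq_iff[OF assms, of a] a greedy by (auto simp: A_def)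
  have sum_greedy: "pair_sum (3, a) = 1/3 + 1 / A"
    by (simp add: pair_sum_def A_def)
  have mem: "(3, a) \<in> U2 \<theta>"
    using a lo by (simp add: U2_def sum_greedy)
  have J_iff: "\<theta> \<in> {1/3 + 1 / of_int a2<..1/3 + 1 / (of_int a2 - 1)} \<longleftrightarrow> a = a2" if "2 \<le> a2" for a2
    using greedy2_eq_iff[OF assms that] greedy by simp

  \<comment> \<open>A sum 1/3 + 1/c below \<theta> forces c > a - 1, hence c \<ge> a by integrality,
    with a tie only at c = a.\<close>
  have competitor: "pair_sum q \<le> 1/3 + 1 / A \<and> (pair_sum q = 1/3 + 1 / A \<longrightarrow> c = a)"
    if "q = (3, c)" "q \<in> U2 \<theta>" for q c
  proof -
    have c: "3 \<le> c" and less: "1 / real_of_int c < 1 / (A - 1)"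
      using that hi by (auto simp: U2_def pair_sum_def)
    then have "A - 1 < real_of_int c"
      using A by (simp add: field_simps)
    then have "a \<le> c"
      by (simp add: A_def)
    then have "A \<le> real_of_int c"
      by (simp add: A_def)
    moreover have "c = a" if "1 / real_of_int c = 1 / A"
      using that by (simp add: A_def)
    ultimately show ?thesis
      using that(1) A by (auto simp: pair_sum_def field_simps)
  qed

  \<comment> \<open>Here d is any positive real, since it will also be 60/7 and 84/5.\<close>
  have above: "A - 1 < d" if "1/3 + 1 / d < \<theta>" "0 < d" for d
  proof -
    have "1 / d < 1 / (A - 1)" using that hi by linarith
    then show ?thesis using that A by (simp add: field_simps)
  qed
  have below: "A \<le> d \<longleftrightarrow> 1 / d \<le> 1 / A" if "0 < d" for d
    using that A by (auto simp: field_simps)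

  \<comment> \<open>The sum of (4,5) is 9/20 = 1/3 + 7/60. The only integer a with a - 1 < 60/7 < a
    is 9, and the right end of J(3, 9) is 1/3 + 1/8 = 11/24.\<close>
  have bad9: "\<theta> \<in> {9/20<..11/24}" if "9/20 < \<theta>" "1/3 + 1 / A < 9/20"
  proof -
    have "A - 1 < 60/7" using above[of "60/7"] that by simp
    moreover have "60/7 < A" using below[of "60/7"] that by simp
    ultimately have "a = 9" by (simp add: A_def; linarith)
    then show ?thesis using hi that by (simp add: A_def)
  qed
  \<comment> \<open>Likewise (4,7) has sum 11/28 = 1/3 + 5/84, only a = 17 satisfies a - 1 < 84/5 <
    a, and 1/3 + 1/16 = 19/48.\<close>
  have bad17: "\<theta> \<in> {11/28<..19/48}" if "11/28 < \<theta>" "1/3 + 1 / A < 11/28"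
  proof -
    have "A - 1 < 84/5" using above[of "84/5"] that by simp
    moreover have "84/5 < A" using below[of "84/5"] that by simp
    ultimately have "a = 17" by (simp add: A_def; linarith)
    then show ?thesis using hi that by (simp add: A_def)
  qed
  \<comment> \<open>No integer lies strictly between a - 1 and a, so an integral d never beats the
    greedy pair.\<close>
  have integral: "1 / real_of_int d \<le> 1 / A" if "1/3 + 1 / real_of_int d < \<theta>" "0 < d" for d
    using above[of d] below[of d] that by (simp add: A_def)

  have best_if: "pair_sum q \<le> 1/3 + 1 / A"
    if good: "\<theta> \<notin> {9/20<..11/24} \<union> {11/28<..19/48}" and q: "q \<in> U2 \<theta>" for q
  proof (cases "1/3 < pair_sum q")
    case False
    then show ?thesis using A by (simp add: add_increasing2)
  next
    case True
    have less: "pair_sum q < \<theta>"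
      using q by (auto simp: U2_def)
    show ?thesis
      using U2_cases[OF assms q True]
    proof
      assume "fst q = 3"
      then show ?thesis using competitor q by (cases q) auto
    next
      assume "q \<in> {(4,5), (4,6), (4,7), (4,8), (4,9), (4,10), (4,11), (5,5), (5,6), (5,7)}"
      then consider "pair_sum q = 9/20" | "pair_sum q = 11/28"
        | d where "0 < d" "pair_sum q = 1/3 + 1 / real_of_int d"
      proof (elim insertE emptyE)
        assume "q = (4,5)" then show ?thesis using that(1) by (simp add: pair_sum_def)
      next
        assume "q = (4,6)" then show ?thesis using that(3)[of 12] by (simp add: pair_sum_def)
      next
        assume "q = (4,7)" then show ?thesis using that(2) by (simp add: pair_sum_def)
      next
        assume "q = (4,8)" then show ?thesis using that(3)[of 24] by (simp add: pair_sum_def)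
      next
        assume "q = (4,9)" then show ?thesis using that(3)[of 36] by (simp add: pair_sum_def)
      next
        assume "q = (4,10)" then show ?thesis using that(3)[of 60] by (simp add: pair_sum_def)
      next
        assume "q = (4,11)" then show ?thesis using that(3)[of 132] by (simp add: pair_sum_def)
      next
        assume "q = (5,5)" then show ?thesis using that(3)[of 15] by (simp add: pair_sum_def)
      next
        assume "q = (5,6)" then show ?thesis using that(3)[of 30] by (simp add: pair_sum_def)
      next
        assume "q = (5,7)" then show ?thesis using that(3)[of 105] by (simp add: pair_sum_def)
      qed
      then show ?thesis
      proof cases
        case 1
        show ?thesis
        proof (rule ccontr)
          assume "\<not> ?thesis"
          then show False using bad9 1 less good by simp
        qed
      next
        case 2
        show ?thesis
        proof (rule ccontr)
          assume "\<not> ?thesis"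
          then show False using bad17 2 less good by simp
        qed
      next
        case (3 d)
        then show ?thesis using integral[of d] less by simp
      qed
    qed
  qed

  have best_iff: "best_underapprox2 \<theta> (3, a) \<longleftrightarrow> \<theta> \<notin> {9/20<..11/24} \<union> {11/28<..19/48}"
  proof
    assume best: "best_underapprox2 \<theta> (3, a)"
    show "\<theta> \<notin> {9/20<..11/24} \<union> {11/28<..19/48}"
    proof
      assume "\<theta> \<in> {9/20<..11/24} \<union> {11/28<..19/48}"
      then show False
      proof
        assume bad: "\<theta> \<in> {9/20<..11/24}"
        then have "(4, 5) \<in> U2 \<theta>" by (simp add: U2_def pair_sum_def)
        then have "pair_sum (4, 5) \<le> pair_sum (3, a)"
          using best unfolding best_underapprox2_iff by blast
        then have "9/20 \<le> 1/3 + 1 / A"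
          unfolding sum_greedy by (simp add: pair_sum_def)
        then have "A \<le> 60/7" using below[of "60/7"] by simp
        \<comment> \<open>Since 11/24 = 1/3 + 1/8, the lower bound \<open>lo\<close> gives 1/A <
          1/8. No integer lies in (8, 60/7].\<close>
        moreover have "8 < A" using below[of 8] lo bad by auto
        ultimately show False by (simp add: A_def; linarith)
      next
        assume bad: "\<theta> \<in> {11/28<..19/48}"
        then have "(4, 7) \<in> U2 \<theta>" by (simp add: U2_def pair_sum_def)
        then have "pair_sum (4, 7) \<le> pair_sum (3, a)"
          using best unfolding best_underapprox2_iff by blast
        then have "11/28 \<le> 1/3 + 1 / A"
          unfolding sum_greedy by (simp add: pair_sum_def)
        then have "A \<le> 84/5" using below[of "84/5"] by simp
        \<comment> \<open>Since 19/48 = 1/3 + 1/16, \<open>lo\<close> gives 1/A < 1/16. No integer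
          lies in (16, 84/5].\<close>
        moreover have "16 < A" using below[of 16] lo bad by auto
        ultimately show False by (simp add: A_def; linarith)
      qed
    qed
  next
    assume "\<theta> \<notin> {9/20<..11/24} \<union> {11/28<..19/48}"
    then show "best_underapprox2 \<theta> (3, a)"
      using mem best_if sum_greedy by (auto simp: best_underapprox2_iff)
  qed

  have tie_iff: "(\<exists>q \<in> U2 \<theta>. q \<noteq> (3, a) \<and> pair_sum q = pair_sum (3, a)) \<longleftrightarrow>
    a \<in> {12, 15, 24, 30, 36, 60, 105, 132}"
  proof
    assume "\<exists>q \<in> U2 \<theta>. q \<noteq> (3, a) \<and> pair_sum q = pair_sum (3, a)"
    then obtain q where q: "q \<in> U2 \<theta>" "q \<noteq> (3, a)" "pair_sum q = 1/3 + 1 / A"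
      using sum_greedy by auto
    then have "1/3 < pair_sum q" using A by simp
    moreover have "fst q \<noteq> 3"
      using competitor q by (cases q) auto
    ultimately have "q \<in> {(4,5), (4,6), (4,7), (4,8), (4,9), (4,10), (4,11), (5,5), (5,6), (5,7)}"
      using U2_cases[OF assms q(1)] by blast
    \<comment> \<open>This expression recovers d from the sum 1/3 + 1/d. A tie makes it equal to the
      integer a, which rules out the two fractions.\<close>
    then have "1 / (pair_sum q - 1/3) \<in> {60/7, 12, 84/5, 24, 36, 60, 132, 15, 30, 105}"
      by (auto simp: pair_sum_def)
    moreover have "1 / (pair_sum q - 1/3) = A"
      using q(3) by simp
    moreover have "A \<noteq> 60/7"
    proof
      assume "A = 60/7"
      then have "real_of_int (7 * a) = real_of_int 60" by (simp add: A_def)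
      then have "7 * a = 60" by (simp only: of_int_eq_iff)
      then show False by presburger
    qed
    moreover have "A \<noteq> 84/5"
    proof
      assume "A = 84/5"
      then have "real_of_int (5 * a) = real_of_int 84" by (simp add: A_def)
      then have "5 * a = 84" by (simp only: of_int_eq_iff)
      then show False by presburger
    qed
    ultimately have "A \<in> {12, 15, 24, 30, 36, 60, 105, 132}"
      by auto
    then show "a \<in> {12, 15, 24, 30, 36, 60, 105, 132}"
      by (simp add: A_def)
  next
    assume "a \<in> {12, 15, 24, 30, 36, 60, 105, 132}"
    then have "\<exists>q \<in> {(4,6), (4,8), (4,9), (4,10), (4,11), (5,5), (5,6), (5,7)}.
      pair_sum q = pair_sum (3, a)"
      by (auto simp: pair_sum_def)
    then obtain q where q: "q \<in> {(4,6), (4,8), (4,9), (4,10), (4,11), (5,5), (5,6), (5,7)}"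
      and eq: "pair_sum q = pair_sum (3, a)"
      by blast
    have "2 \<le> fst q" "fst q \<le> snd q" "q \<noteq> (3, a)"
      using q by auto
    moreover have "pair_sum q < \<theta>"
      using eq sum_greedy lo by simp
    ultimately show "\<exists>q \<in> U2 \<theta>. q \<noteq> (3, a) \<and> pair_sum q = pair_sum (3, a)"
      using eq by (intro bexI[of _ q]) (auto simp: U2_def)
  qed
  \<comment> \<open>The two exceptional intervals lie in J(3, 9) and J(3, 17), and neither 9 nor 17
    is in the list; so a tie occurs only where the greedy pair is best.\<close>
  have tie_good: "\<theta> \<notin> {9/20<..11/24} \<union> {11/28<..19/48}"
    if "a \<in> {12, 15, 24, 30, 36, 60, 105, 132}"
    using that lo hi unfolding A_def by (elim insertE) simp_all

  have J: "(\<exists>a2 \<in> {12, 15, 24, 30, 36, 60, 105, 132 :: int}.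
      \<theta> \<in> {1/3 + 1 / of_int a2<..1/3 + 1 / (of_int a2 - 1)}) \<longleftrightarrow>
    (\<exists>a2 \<in> {12, 15, 24, 30, 36, 60, 105, 132}. a = a2)"
    by (intro bex_cong[OF refl] J_iff) auto
  have "best_underapprox2 \<theta> (3, a) \<and> \<not> unique_best_underapprox2 \<theta> (3, a) \<longleftrightarrow>
    a \<in> {12, 15, 24, 30, 36, 60, 105, 132}"
  proof (cases "best_underapprox2 \<theta> (3, a)")
    case True
    then show ?thesis
      by (simp only: not_unique_best_underapprox2_iff tie_iff simp_thms)
  next
    \<comment> \<open>The left side fails outright, and by \<open>tie_good\<close> a is outside the
      list.\<close>
    case False
    then show ?thesis
      using tie_good unfolding best_iff by metis
  qed
  also have "\<dots> \<longleftrightarrow> (\<exists>a2 \<in> {12, 15, 24, 30, 36, 60, 105, 132}. a = a2)"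
    by simp
  finally show ?thesis
    unfolding greedy J using best_iff by (intro conjI)
qed

end
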